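(* Let $\mathcal{F}$ be a filter on $\mathbb{N}$ and let $X$ be a Banach space over $\mathbb{K}$ with an $\mathcal{F}$-basis $(e_n)_{n=1}^\infty$ whose coordinate functionals $e_n^*$ ($n\in\mathbb{N}$) are continuous. If $(f_n)_{n=1}^\infty$ is a sequence in $X$ such that $$\sum_{n=1}^\infty \|f_n-e_n\|\cdot\|e_n^*\|\leqslant\delta$$ for some $\delta\in(0,1)$, then $(f_n)_{n=1}^\infty$ is congruent to $(e_n)_{n=1}^\infty$, that is, $(f_n)_{n=1}^\infty$ is an $\mathcal{F}$-basis of $X$ and the assignment $e_n\mapsto f_n$ ($n\in\mathbb{N}$) extends to a surjective isomorphism (linear homeomorphism) of $X$ onto itself.
   Context: $\mathbb{K}$ is the fixed scalar field, either $\mathbb{R}$ or $\mathbb{C}$. A filter on $\mathbb{N}=\{1,2,\dots\}$ is a family of subsets of $\mathbb{N}$ closed under finite intersections and upwards-closed with respect to inclusion; by convention, every filter is assumed to contain all cofinite subsets of $\mathbb{N}$. A sequence $(x_n)_{n=1}^\infty$ in a normed space $\mathcal{F}$-converges to $x$ if for every $\varepsilon>0$ there is $A\in\mathcal{F}$ such that $\|x-x_n\|<\varepsilon$ for all $n\in A$. A sequence $(e_n)_{n=1}^\infty$ in a Banach space $X$ is an $\mathcal{F}$-basis of $X$ if for each $x\in X$ there is a unique sequence of scalars $(e_n^*(x))_{n=1}^\infty$ such that $x=\sum_{n,\mathcal{F}}e_n^*(x)e_n$, meaning that the partial sums $\sum_{i=1}^n e_i^*(x)e_i$ $\mathcal{F}$-converge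 to $x$. The linear maps $x\mapsto e_n^*(x)$ are the coordinate functionals of the basis, and $\|e_n^*\|$ denotes the dual norm. *)

theory Defs
  imports "HOL-Analysis.Analysis"
begin

(* The scalar field K ranges over the class real_normed_field, whose norm is multiplicative.
   By the Gelfand-Mazur theorem its instances are, up to isometric isomorphism, exactly R and C,
   so this is a uniform treatment of real and complex Banach spaces.  The class banach supplies
   the complete norm and the underlying real space; smul is the K-scalar multiplication. *)
locale banach_space_over = vector_space smul
  for smul :: "'k::real_normed_field \<Rightarrow> 'a::banach \<Rightarrow> 'a" +
  assumes norm_scale: "norm (smul c x) = norm c * norm x"
    and scale_of_real: "smul (of_real r) x = r *\<^sub>R x"

lemma banach_space_over_scaleR:
  "banach_space_over (scaleR :: real \<Rightarrow> 'a::banach \<Rightarrow> 'a)"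
  by unfold_locales (auto simp: algebra_simps)

lemma banach_space_over_mult:
  "banach_space_over ((*) :: 'k::{real_normed_field,banach} \<Rightarrow> 'k \<Rightarrow> 'k)"
  by unfold_locales (auto simp: algebra_simps norm_mult scaleR_conv_of_real)

(* Sequences are indexed from 0 instead of 1.  Under the shift n |-> n + 1 the n-th partial sum
   has to include the term with index n, hence the closed range of summation. *)
definition filter_sums ::
  "('k::real_normed_field \<Rightarrow> 'a::banach \<Rightarrow> 'a) \<Rightarrow> nat filter \<Rightarrow> (nat \<Rightarrow> 'a) \<Rightarrow> (nat \<Rightarrow> 'k) \<Rightarrow> 'a \<Rightarrow> bool"
  where "filter_sums smul F e c x \<longleftrightarrow> ((\<lambda>n. \<Sum>i\<le>n. smul (c i) (e i)) \<longlongrightarrow> x) F"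

definition filter_basis ::
  "('k::real_normed_field \<Rightarrow> 'a::banach \<Rightarrow> 'a) \<Rightarrow> nat filter \<Rightarrow> (nat \<Rightarrow> 'a) \<Rightarrow> bool"
  where "filter_basis smul F e \<longleftrightarrow> (\<forall>x. \<exists>!c. filter_sums smul F e c x)"

definition coord_functional ::
  "('k::real_normed_field \<Rightarrow> 'a::banach \<Rightarrow> 'a) \<Rightarrow> nat filter \<Rightarrow> (nat \<Rightarrow> 'a) \<Rightarrow> nat \<Rightarrow> 'a \<Rightarrow> 'k"
  where "coord_functional smul F e n x = (THE c. filter_sums smul F e c x) n"

definition congruent_basis ::
  "('k::real_normed_field \<Rightarrow> 'a::banach \<Rightarrow> 'a) \<Rightarrow> nat filter \<Rightarrow> (nat \<Rightarrow> 'a) \<Rightarrow> (nat \<Rightarrow> 'a) \<Rightarrow> bool"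
  where "congruent_basis smul F e f \<longleftrightarrow>
    filter_basis smul F f \<and>
    (\<exists>T S. Vector_Spaces.linear smul smul T \<and> homeomorphism UNIV UNIV T S \<and>
           (\<forall>n. T (e n) = f n))"

end

theory Submission imports Defs begin

text \<open>
  Put \<open>R x = (\<Sum>n. e\<^sub>n\<^sup>*(x) (f\<^sub>n - e\<^sub>n))\<close>. The hypothesis makes this series converge absolutely
  with \<open>\<parallel>R x\<parallel> \<le> \<delta> \<parallel>x\<parallel>\<close>, so that \<open>T = I + R\<close> is a perturbation of the identity by a strict
  contraction. Such a map is a linear homeomorphism: solving \<open>T x = y\<close> means finding a fixed point
  of the contraction \<open>x \<mapsto> y - R x\<close>, and \<open>\<parallel>T x\<parallel> \<ge> (1 - \<delta>) \<parallel>x\<parallel>\<close> makes the inverse Lipschitz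
  (\<open>homeomorphism_id_plus_contraction\<close>). By biorthogonality of the coordinate functionals
  (\<open>coord_functional_basis_vector\<close>), \<open>T e\<^sub>n = e\<^sub>n + (f\<^sub>n - e\<^sub>n) = f\<^sub>n\<close>.

  Finally, a linear homeomorphism commutes with partial sums and with limits along any filter, hence
  maps bases to bases (\<open>filter_basis_image\<close>).

  The filter enters through the compatibility of its limits with the linear structure, and through
  its containing the cofinite sets, which gives the finite expansion of each \<open>e\<^sub>k\<close>. Along an improper
  filter every sequence tends to every point, but then no sequence is a basis, because every
  coefficient sequence represents every vector. Uniqueness of coefficients is therefore always taken
  from the basis property and never from uniqueness of limits.
\<close>

section \<open>Bounded perturbations of the identity\<close>

lemma linear_continuous_imp_bounded_linear:
  fixes g :: "'a::real_normed_vector \<Rightarrow> 'b::real_normed_vector"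
  assumes lin: "linear g" and cont: "continuous_on UNIV g"
  shows "bounded_linear g"
proof -
  interpret linear g by fact
  have "isCont g 0"
    using cont by (simp add: continuous_on_eq_continuous_at)
  then obtain s where s: "s > 0" "\<And>x. norm x < s \<Longrightarrow> norm (g x) < 1"
    unfolding continuous_at_eps_delta using zero_less_one
    by (metis (no_types) zero dist_0_norm dist_commute)
  have "norm (g x) \<le> norm x * (2 / s)" for x
  proof (cases "x = 0")
    case False
    define r where "r = s / (2 * norm x)"
    have r: "r > 0" using False s by (simp add: r_def)
    have "norm (r *\<^sub>R x) < s"
      using False s by (simp add: r_def)
    then have "norm (g (r *\<^sub>R x)) < 1"
      by (rule s(2))
    then have "r * norm (g x) < 1"
      using r by (simp add: scale)
    then show ?thesis
      using False s by (simp add: r_def field_simps)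
  qed (simp add: zero)
  with lin show ?thesis
    unfolding bounded_linear_def bounded_linear_axioms_def by blast
qed

text \<open>
  This is the part of the Neumann series argument that is needed, obtained from Banach's fixed
  point theorem instead of a series of operators.
\<close>

lemma homeomorphism_id_plus_contraction:
  fixes R :: "'a::banach \<Rightarrow> 'a"
  assumes add: "\<And>x y. R (x + y) = R x + R y"
    and bound: "\<And>x. norm (R x) \<le> \<delta> * norm x"
    and \<delta>: "0 \<le> \<delta>" "\<delta> < 1"
  shows "\<exists>S. homeomorphism UNIV UNIV (\<lambda>x. x + R x) S"
proof -
  let ?T = "\<lambda>x. x + R x"
  have diff: "R (x - y) = R x - R y" for x y
    using add[of "x - y" y] by (simp add: algebra_simps)
  have R_lipschitz: "dist (R x) (R y) \<le> \<delta> * dist x y" for x y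
    using bound[of "x - y"] by (simp add: dist_norm diff)
  have "\<exists>!x. y - R x = x" for y
    using R_lipschitz by (intro banach_fix_type[OF \<delta>]) (simp add: dist_norm norm_minus_commute)
  moreover have "y - R x = x \<longleftrightarrow> ?T x = y" for x y
    by (auto simp: algebra_simps)
  ultimately have "\<exists>!x. ?T x = y" for y
    by simp
  then obtain S where TS: "\<And>y. ?T (S y) = y" and ST: "\<And>x. S (?T x) = x"
    by metis
  have T_expanding: "(1 - \<delta>) * dist x y \<le> dist (?T x) (?T y)" for x y
  proof -
    have "dist x y = norm ((?T x - ?T y) - (R x - R y))"
      by (simp add: dist_norm)
    also have "\<dots> \<le> norm (?T x - ?T y) + norm (R x - R y)"
      by (rule norm_triangle_ineq4)
    finally show ?thesis
      using R_lipschitz[of x y] by (simp add: dist_norm algebra_simps)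
  qed
  have "\<delta>-lipschitz_on UNIV R"
    using R_lipschitz \<delta> by (intro lipschitz_onI) auto
  then have contT: "continuous_on UNIV ?T"
    by (intro continuous_intros lipschitz_on_continuous_on)
  have "(1 / (1 - \<delta>))-lipschitz_on UNIV S"
  proof (rule lipschitz_onI)
    show "dist (S x) (S y) \<le> 1 / (1 - \<delta>) * dist x y" for x y
      using T_expanding[of "S x" "S y"] \<delta> by (simp add: TS field_simps)
  qed (use \<delta> in simp)
  then have contS: "continuous_on UNIV S"
    by (rule lipschitz_on_continuous_on)
  have "homeomorphism UNIV UNIV ?T S"
    using contT contS TS ST by (intro homeomorphismI) auto
  then show ?thesis
    by blast
qed

section \<open>Coordinate functionals\<close>

lemma filter_sums_coord_functional:
  assumes "filter_basis smul F e"
  shows "filter_sums smul F e (\<lambda>n. coord_functional smul F e n x) x"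
  using theI'[of "\<lambda>c. filter_sums smul F e c x"] assms
  by (simp add: filter_basis_def coord_functional_def)

lemma coord_functional_eqI:
  assumes "filter_basis smul F e" and "filter_sums smul F e c x"
  shows "coord_functional smul F e n x = c n"
proof -
  have "(\<lambda>n. coord_functional smul F e n x) = c"
    using assms filter_sums_coord_functional[OF assms(1), of x]
    by (auto simp: filter_basis_def)
  then show ?thesis
    by (rule fun_cong)
qed

context banach_space_over
begin

lemma bounded_linear_smul_right: "bounded_linear (smul c)"
proof (rule bounded_linear_intro)
  show "smul c (r *\<^sub>R x) = r *\<^sub>R smul c x" for r x
    by (metis scale_of_real scale_left_commute)
  show "norm (smul c x) \<le> norm x * norm c" for x
    by (simp add: norm_scale)
qed (rule scale_right_distrib)

lemma coord_functional_add:
  assumes basis: "filter_basis smul F e"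
  shows "coord_functional smul F e n (x + y) =
    coord_functional smul F e n x + coord_functional smul F e n y"
proof (rule coord_functional_eqI[OF basis])
  show "filter_sums smul F e
      (\<lambda>n. coord_functional smul F e n x + coord_functional smul F e n y) (x + y)"
    using tendsto_add[OF filter_sums_coord_functional[OF basis, of x, unfolded filter_sums_def]
        filter_sums_coord_functional[OF basis, of y, unfolded filter_sums_def]]
    by (simp add: filter_sums_def scale_left_distrib sum.distrib)
qed

lemma coord_functional_smul:
  assumes basis: "filter_basis smul F e"
  shows "coord_functional smul F e n (smul c x) = c * coord_functional smul F e n x"
proof (rule coord_functional_eqI[OF basis])
  show "filter_sums smul F e (\<lambda>n. c * coord_functional smul F e n x) (smul c x)"
    using bounded_linear.tendsto[OF bounded_linear_smul_right
        filter_sums_coord_functional[OF basis, of x, unfolded filter_sums_def], of c]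
    by (simp add: filter_sums_def scale_sum_right)
qed

text \<open>
  The \<open>k\<close>-th unit coefficient sequence represents \<open>e\<^sub>k\<close>, since its partial sums equal \<open>e\<^sub>k\<close> on the
  cofinite set of indices from \<open>k\<close> on.
\<close>

lemma coord_functional_basis_vector:
  assumes basis: "filter_basis smul F e" and F: "F \<le> cofinite"
  shows "coord_functional smul F e n (e k) = (if n = k then 1 else 0)"
proof (rule coord_functional_eqI[OF basis])
  have partial_sum: "(\<Sum>i\<le>n. smul (if i = k then 1 else 0) (e i)) = e k" if "n \<ge> k" for n
  proof -
    have "(\<Sum>i\<le>n. smul (if i = k then 1 else 0) (e i)) = (\<Sum>i\<le>n. if i = k then e i else 0)"
      by (intro sum.cong) auto
    then show ?thesis
      using that by simp
  qed
  have "eventually (\<lambda>n. n \<ge> k) F"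
    using filter_leD[OF F] eventually_ge_at_top[of k] by (simp add: cofinite_eq_sequentially)
  then have "eventually (\<lambda>n. (\<Sum>i\<le>n. smul (if i = k then 1 else 0) (e i)) = e k) F"
    by (rule eventually_mono) (rule partial_sum)
  then show "filter_sums smul F e (\<lambda>n. if n = k then 1 else 0) (e k)"
    unfolding filter_sums_def by (rule tendsto_eventually)
qed

lemma bounded_linear_coord_functional:
  assumes basis: "filter_basis smul F e"
    and "continuous_on UNIV (coord_functional smul F e n)"
  shows "bounded_linear (coord_functional smul F e n)"
proof (rule linear_continuous_imp_bounded_linear[OF linearI])
  show "coord_functional smul F e n (r *\<^sub>R x) = r *\<^sub>R coord_functional smul F e n x" for r x
    using coord_functional_smul[OF basis, of n "of_real r" x]
    by (simp add: scale_of_real scaleR_conv_of_real)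
qed (use assms coord_functional_add in auto)

section \<open>Images of bases under linear homeomorphisms\<close>

text \<open>
  \<open>T\<close> and its inverse exchange the expansions of \<open>y\<close> along \<open>T e\<^sub>n\<close> with those of \<open>S y\<close> along
  \<open>e\<^sub>n\<close>, with the same coefficients.
\<close>

lemma filter_basis_image:
  assumes lin: "Vector_Spaces.linear smul smul T" and homeo: "homeomorphism UNIV UNIV T S"
    and basis: "filter_basis smul F e"
  shows "filter_basis smul F (\<lambda>n. T (e n))"
proof -
  interpret T: Vector_Spaces.linear smul smul T by fact
  have contT: "isCont T x" and contS: "isCont S x" for x
    using homeo by (auto simp: homeomorphism_def continuous_on_eq_continuous_at)
  have ST: "S (T x) = x" and TS: "T (S x) = x" for x
    using homeo by (auto simp: homeomorphism_def)
  have partial_sum: "(\<Sum>i\<le>n. smul (c i) (T (e i))) = T (\<Sum>i\<le>n. smul (c i) (e i))" for c n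
    by (simp add: T.sum T.scale)
  have "filter_sums smul F (\<lambda>n. T (e n)) c y \<longleftrightarrow> filter_sums smul F e c (S y)" for c y
  proof
    assume "filter_sums smul F (\<lambda>n. T (e n)) c y"
    then show "filter_sums smul F e c (S y)"
      unfolding filter_sums_def partial_sum
      by (auto dest: isCont_tendsto_compose[OF contS] simp: ST)
  next
    assume "filter_sums smul F e c (S y)"
    then show "filter_sums smul F (\<lambda>n. T (e n)) c y"
      unfolding filter_sums_def partial_sum
      by (auto dest: isCont_tendsto_compose[OF contT] simp: TS)
  qed
  then show ?thesis
    using basis by (simp add: filter_basis_def)
qed

section \<open>The small perturbation theorem\<close>

text \<open>
  The abstract form of the operator \<open>R\<close>: a series of rank-one operators \<open>x \<mapsto> a\<^sub>n(x) d\<^sub>n\<close> whose norms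
  \<open>\<parallel>a\<^sub>n\<parallel> \<parallel>d\<^sub>n\<parallel>\<close> are summable. At a point \<open>x\<close> the terms are dominated by \<open>\<parallel>d\<^sub>n\<parallel> \<parallel>a\<^sub>n\<parallel> \<parallel>x\<parallel>\<close>, which
  gives both the convergence and the bound on the sum.
\<close>

lemma nuclear_series:
  assumes a: "\<And>n. bounded_linear (a n)"
    and a_smul: "\<And>n c x. a n (smul c x) = c * a n x"
    and summable: "summable (\<lambda>n. norm (d n) * onorm (a n))"
  defines "R \<equiv> \<lambda>x. \<Sum>n. smul (a n x) (d n)"
  shows "R (x + y) = R x + R y"
    and "R (smul c x) = smul c (R x)"
    and "norm (R x) \<le> (\<Sum>n. norm (d n) * onorm (a n)) * norm x"
proof -
  have term_bound: "norm (smul (a n x) (d n)) \<le> norm (d n) * onorm (a n) * norm x" for n x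
    using mult_left_mono[OF onorm[OF a[of n], of x] norm_ge_zero[of "d n"]]
    by (simp add: norm_scale mult_ac)
  have conv: "summable (\<lambda>n. smul (a n x) (d n))" for x
    by (rule summable_comparison_test'[OF summable_mult2[OF summable] term_bound])
  show "R (x + y) = R x + R y"
    using suminf_add[OF conv[of x] conv[of y]]
    by (simp add: R_def linear_simps(1)[OF a] scale_left_distrib)
  show "R (smul c x) = smul c (R x)"
    using bounded_linear.suminf[OF bounded_linear_smul_right conv[of x], of c]
    by (simp add: R_def a_smul)
  show "norm (R x) \<le> (\<Sum>n. norm (d n) * onorm (a n)) * norm x"
    using norm_suminf_le[OF term_bound summable_mult2[OF summable]]
    by (simp add: R_def suminf_mult2[OF summable])
qed

end

theorem theoremC:
  fixes smul :: "'k::real_normed_field \<Rightarrow> 'a::banach \<Rightarrow> 'a"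
    and F :: "nat filter"
    and e f :: "nat \<Rightarrow> 'a"
    and \<delta> :: real
  assumes "banach_space_over smul"
    and "F \<le> cofinite"
    and "filter_basis smul F e"
    and "\<And>n. continuous_on UNIV (coord_functional smul F e n)"
    and "0 < \<delta>" and "\<delta> < 1"
    and "summable (\<lambda>n. norm (f n - e n) * onorm (coord_functional smul F e n))"
    and "(\<Sum>n. norm (f n - e n) * onorm (coord_functional smul F e n)) \<le> \<delta>"
  shows "congruent_basis smul F e f"
proof -
  interpret banach_space_over smul by fact
  note basis = assms(3)
  let ?a = "coord_functional smul F e"
  define R where "R x = (\<Sum>n. smul (?a n x) (f n - e n))" for x
  define T where "T = (\<lambda>x. x + R x)"
  note R = nuclear_series[where a = ?a and d = "\<lambda>n. f n - e n",
      OF bounded_linear_coord_functional[OF basis assms(4)] coord_functional_smul[OF basis] assms(7),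
      folded R_def]
  have R_bound: "norm (R x) \<le> \<delta> * norm x" for x
    using R(3)[of x] mult_right_mono[OF assms(8) norm_ge_zero[of x]] by linarith
  obtain S where homeo: "homeomorphism UNIV UNIV T S"
    using homeomorphism_id_plus_contraction[of R \<delta>, OF R(1) R_bound] assms(5,6)
    by (auto simp: T_def)
  have lin: "Vector_Spaces.linear smul smul T"
    unfolding Vector_Spaces.linear_iff T_def
    using vector_space_axioms R(1,2) by (simp add: scale_right_distrib)
  have T_e: "T (e k) = f k" for k
  proof -
    have "R (e k) = (\<Sum>n. if n = k then f n - e n else 0)"
      unfolding R_def coord_functional_basis_vector[OF basis assms(2)]
      by (intro suminf_cong) simp
    also have "\<dots> = f k - e k"
      by (rule sums_unique[OF sums_single, symmetric])
    finally show ?thesis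
      by (simp add: T_def)
  qed
  then have "filter_basis smul F f"
    using filter_basis_image[OF lin homeo basis] by simp
  with lin homeo T_e show ?thesis
    unfolding congruent_basis_def by blast
qed

end
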